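(* Let $\lambda,\mu,\nu$ be Young diagrams with $\lambda\subset\nu$ and $|\lambda|+|\mu|=|\nu|$, let $\leqslant_A$ be an admissible order on $\nu\setminus\lambda$ and let $\leqslant_{A'}$ be an admissible order on $\mu$. For $f=(f_1,f_2)\in\mathbf{P}(\mu,\nu\setminus\lambda;A,A')$ let $\Phi(f)$ be the filling of shape $\mu$ whose $(i,j)$-entry is $\Phi(f)_{i,j}:=f_1(i,j)$. For $T\in\mathbf{B}(\mu)^{\nu}_{\lambda}[A']$ let $\Psi(T)$ be the map defined on $\mu$ by $$\Psi(T):(i,j)\longmapsto (T_{i,j},\ \lambda_{T_{i,j}}+p(T;i,j)).$$ Then these formulas give maps $$\Phi:\mathbf{P}(\mu,\nu\setminus\lambda;A,A')\to\mathbf{B}(\mu)^{\nu}_{\lambda}[A'],\qquad \Psi:\mathbf{B}(\mu)^{\nu}_{\lambda}[A']\to\mathbf{P}(\mu,\nu\setminus\lambda;A,A'),$$ which are bijections and are inverse to each other.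
   Context: A Young diagram $\lambda=(\lambda_1\ge\lambda_2\ge\cdots\ge 0)$ is a partition, identified with the set of boxes $(i,j)\in\mathbb{N}\times\mathbb{N}$ (row $i\geq 1$, column $j\geq 1$) with $j\le\lambda_i$; $|\lambda|$ is the number of boxes, and $\lambda_i=0$ beyond the last row. For $\lambda\subset\nu$, $\nu\setminus\lambda$ is the set-theoretic difference (a skew diagram). A positive integer $n$ is fixed (type $A_n$) and all Young diagrams considered have at most $n+1$ rows. Orders on $X\subset\mathbb{N}\times\mathbb{N}$: $(a,b)\leqslant_P(c,d)$ iff $a\le c$ and $b\le d$ (partial order). A total order $\leqslant_A$ on $X$ is called admissible if for all $(a,b),(c,d)\in X$, $a\le c$ and $b\ge d$ imply $(a,b)\leqslant_A(c,d)$. Pictures: for $X,Y\subset\mathbb{N}\times\mathbb{N}$ and an admissible order $\leqslant_A$ on $Y$, a map $f:X\to Y$ is $PA$-standard if $x\leqslant_P x'$ implies $f(x)\leqslant_A f(x')$ for all $x,x'\in X$. Given admissible orders $\leqslant_A$ on $\nu\setminus\lambda$ and $\leqslant_{A'}$ on $\mu$, $\mathbf{P}(\mu,\nu\setminus\lambda;A,A')$ is the set of $(A,A')$-admissible pictures, i.e. bijections $f:\mu\to\nu\setminus\lambda$ such that $f$ is $PA$-standard and $f^{-1}:\nu\setminus\lambda\to\mu$ is $PA'$-standard. Write $f=(f_1,f_2)$ for the two coordinates of $f$ in $\mathbb{N}\times\mathbb{N}$. Tableaux: a Young tableau is a semistandard tableau (entries weakly increasing along rows left to right, strictly increasing down columns).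 $\mathbf{B}(\mu)$ is the set of Young tableaux of shape $\mu$ with entries in $\{1,\dots,n+1\}$; $T_{i,j}$ is the entry in box $(i,j)$. For $k>0$, $T^{(k)}=\{(l,m)\in\mu: T_{l,m}=k\}$, which has at most one box per column. If $T_{i,j}=k$, $p(T;i,j)$ is the position of $(i,j)$ in $T^{(k)}$ counted from the right (the right-most box of $T^{(k)}$ has position $1$). Readings: for an admissible order $\leqslant_{A'}$ on $\mu$ with $N=|\mu|$, $R_{A'}(T)$ is the sequence $(i_1,\dots,i_N)$ (written $i_1\otimes\cdots\otimes i_N$ in the crystal setting) of entries of $T$ read in increasing order of their boxes with respect to $\leqslant_{A'}$. Additions: $\lambda[i]$ is obtained from $\lambda=(\lambda_1,\lambda_2,\dots)$ by replacing $\lambda_i$ by $\lambda_i+1$, and $\lambda[i_1,\dots,i_k]:=(\cdots((\lambda[i_1])[i_2])\cdots)[i_k]$; this need not be a Young diagram. $\mathbf{B}(\mu)^{\nu}_{\lambda}[A']$ is the set of $T\in\mathbf{B}(\mu)$ such that, writing $R_{A'}(T)=(i_1,\dots,i_N)$, the diagram $\lambda[i_1,\dots,i_k]$ is a Young diagram for every $k=1,\dots,N$ and $\lambda[i_1,\dots,i_N]=\nu$. *)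

theory Defs
  imports "HOL-Library.FuncSet"
begin

type_synonym box = "nat \<times> nat"

text \<open>Rows and columns are numbered from 1. A partition is the function sending a row number to
  its length; the value at the unused row number 0 is fixed to be 0, so that equality of functions
  is equality of partitions.\<close>

definition young_diagram :: "(nat \<Rightarrow> nat) \<Rightarrow> bool" where
  "young_diagram lam \<longleftrightarrow>
     lam 0 = 0 \<and> (\<forall>i\<ge>1. lam (Suc i) \<le> lam i) \<and> (\<exists>r. \<forall>i>r. lam i = 0)"

definition at_most_rows :: "nat \<Rightarrow> (nat \<Rightarrow> nat) \<Rightarrow> bool" where
  "at_most_rows r lam \<longleftrightarrow> (\<forall>i>r. lam i = 0)"

definition boxes :: "(nat \<Rightarrow> nat) \<Rightarrow> box set" where
  "boxes lam = {(i, j). 1 \<le> i \<and> 1 \<le> j \<and> j \<le> lam i}"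

definition le_P :: "box \<Rightarrow> box \<Rightarrow> bool" where
  "le_P = (\<lambda>(a, b) (c, d). a \<le> c \<and> b \<le> d)"

definition admissible_order :: "box set \<Rightarrow> box rel \<Rightarrow> bool" where
  "admissible_order X A \<longleftrightarrow> linear_order_on X A \<and>
     (\<forall>(a, b) \<in> X. \<forall>(c, d) \<in> X. a \<le> c \<and> b \<ge> d \<longrightarrow> ((a, b), (c, d)) \<in> A)"

definition PA_standard :: "box set \<Rightarrow> box set \<Rightarrow> box rel \<Rightarrow> (box \<Rightarrow> box) \<Rightarrow> bool" where
  "PA_standard X Y A f \<longleftrightarrow>
     f \<in> X \<rightarrow> Y \<and> (\<forall>x\<in>X. \<forall>x'\<in>X. le_P x x' \<longrightarrow> (f x, f x') \<in> A)"

text \<open>Maps and fillings defined on a finite set of boxes are represented by functions that are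
  \<open>undefined\<close> elsewhere, so that equality of functions is equality of maps.\<close>

definition pictures :: "box set \<Rightarrow> box set \<Rightarrow> box rel \<Rightarrow> box rel \<Rightarrow> (box \<Rightarrow> box) set" where
  "pictures X Y A A' = {f \<in> extensional X. bij_betw f X Y \<and>
     PA_standard X Y A f \<and> PA_standard Y X A' (inv_into X f)}"

definition young_tableaux :: "nat \<Rightarrow> (nat \<Rightarrow> nat) \<Rightarrow> (box \<Rightarrow> nat) set" where
  "young_tableaux n mu = {T \<in> boxes mu \<rightarrow>\<^sub>E {1..n + 1}.
     (\<forall>i j j'. (i, j) \<in> boxes mu \<and> (i, j') \<in> boxes mu \<and> j < j' \<longrightarrow> T (i, j) \<le> T (i, j')) \<and>
     (\<forall>i i' j. (i, j) \<in> boxes mu \<and> (i', j) \<in> boxes mu \<and> i < i' \<longrightarrow> T (i, j) < T (i', j))}"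

definition entry_boxes :: "(nat \<Rightarrow> nat) \<Rightarrow> (box \<Rightarrow> nat) \<Rightarrow> nat \<Rightarrow> box set" where
  "entry_boxes mu T k = {x \<in> boxes mu. T x = k}"

text \<open>As \<open>entry_boxes mu T k\<close> has at most one box per column for a Young tableau, the position of
  one of its boxes counted from the right is the number of its boxes in the same column or
  further to the right.\<close>

definition position :: "(nat \<Rightarrow> nat) \<Rightarrow> (box \<Rightarrow> nat) \<Rightarrow> nat \<Rightarrow> nat \<Rightarrow> nat" where
  "position mu T i j = card {(l, m) \<in> entry_boxes mu T (T (i, j)). j \<le> m}"

text \<open>Meaningful for a finite set \<open>X\<close> linearly ordered by \<open>A\<close>, in which case the list exists and
  is unique.\<close>

definition ordered_list :: "'a set \<Rightarrow> 'a rel \<Rightarrow> 'a list" where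
  "ordered_list X A =
     (THE xs. set xs = X \<and> distinct xs \<and> sorted_wrt (\<lambda>x y. (x, y) \<in> A) xs)"

definition reading :: "(nat \<Rightarrow> nat) \<Rightarrow> box rel \<Rightarrow> (box \<Rightarrow> nat) \<Rightarrow> nat list" where
  "reading mu A' T = map T (ordered_list (boxes mu) A')"

definition addition :: "(nat \<Rightarrow> nat) \<Rightarrow> nat \<Rightarrow> (nat \<Rightarrow> nat)" where
  "addition lam i = lam(i := lam i + 1)"

definition additions :: "(nat \<Rightarrow> nat) \<Rightarrow> nat list \<Rightarrow> (nat \<Rightarrow> nat)" where
  "additions lam is = foldl addition lam is"

definition LR_tableaux ::
    "nat \<Rightarrow> (nat \<Rightarrow> nat) \<Rightarrow> (nat \<Rightarrow> nat) \<Rightarrow> (nat \<Rightarrow> nat) \<Rightarrow> box rel \<Rightarrow> (box \<Rightarrow> nat) set" where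
  "LR_tableaux n mu lam nu A' = {T \<in> young_tableaux n mu.
     (\<forall>k \<in> {1..length (reading mu A' T)}.
        young_diagram (additions lam (take k (reading mu A' T)))) \<and>
     additions lam (reading mu A' T) = nu}"

definition Phi :: "(nat \<Rightarrow> nat) \<Rightarrow> (box \<Rightarrow> box) \<Rightarrow> (box \<Rightarrow> nat)" where
  "Phi mu f = (\<lambda>(i, j) \<in> boxes mu. fst (f (i, j)))"

definition Psi :: "(nat \<Rightarrow> nat) \<Rightarrow> (nat \<Rightarrow> nat) \<Rightarrow> (box \<Rightarrow> nat) \<Rightarrow> (box \<Rightarrow> box)" where
  "Psi lam mu T = (\<lambda>(i, j) \<in> boxes mu. (T (i, j), lam (T (i, j)) + position mu T i j))"

end

theory Submission
  imports Defs
begin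

text \<open>Call a box weakly south-west of another one if its row index is weakly larger and its column
  index weakly smaller. Let \<open>lam\<^sub>x\<close> be the shape obtained from \<open>lam\<close> by adding the entries of \<open>T\<close>
  read up to the box \<open>x\<close>. Since equal entries of a Young tableau are read from right to left,
  \<open>Psi lam mu T\<close> sends \<open>x\<close> to the box that is added when \<open>x\<close> is read, so that the image of \<open>w\<close> is a
  box of \<open>lam\<^sub>x\<close> if and only if \<open>w\<close> is read no later than \<open>x\<close>. Thus all the \<open>lam\<^sub>x\<close> are
  Young diagrams exactly when the inverse of \<open>Psi lam mu T\<close> is standard.

  Two steps depend on the admissible orders being arbitrary: that the row coordinate of a
  picture increases weakly along rows, and that \<open>Psi lam mu T\<close> maps each box of a column weakly
  south-west of the image of every higher one. In both of them the images of a violating pair span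
  a rectangle inside the skew diagram; the preimage of a further corner of this rectangle
  yields a violating pair in a row further up, or in a column further left, respectively.\<close>

subsection \<open>Boxes and orders\<close>

lemma mem_boxes_iff: "(i, j) \<in> boxes lam \<longleftrightarrow> 1 \<le> i \<and> 1 \<le> j \<and> j \<le> lam i"
  by (simp add: boxes_def)

lemma le_P_iff: "le_P (a, b) (c, d) \<longleftrightarrow> a \<le> c \<and> b \<le> d"
  by (simp add: le_P_def)

lemma young_diagram_antimono:
  assumes "young_diagram lam" "1 \<le> i" "i \<le> k"
  shows "lam k \<le> lam i"
  using assms(3,2)
proof (induction k rule: dec_induct)
  case (step k)
  with assms(1) have "lam (Suc k) \<le> lam k"
    by (simp add: young_diagram_def)
  with step show ?case by simp
qed simp

lemma finite_boxes:
  assumes "young_diagram lam"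
  shows "finite (boxes lam)"
proof -
  from assms obtain r where r: "\<forall>i>r. lam i = 0"
    by (auto simp: young_diagram_def)
  have "boxes lam \<subseteq> (SIGMA i:{..r}. {..lam i})"
  proof
    fix x assume "x \<in> boxes lam"
    with r show "x \<in> (SIGMA i:{..r}. {..lam i})"
      by (cases x) (force simp: mem_boxes_iff not_less[symmetric])
  qed
  then show ?thesis
    by (rule finite_subset) auto
qed

lemma boxes_subset_imp_le:
  assumes "young_diagram lam" "boxes lam \<subseteq> boxes nu"
  shows "lam r \<le> nu r"
proof (cases "r = 0 \<or> lam r = 0")
  case True
  then show ?thesis
    using assms(1) by (auto simp: young_diagram_def)
next
  case False
  then have "(r, lam r) \<in> boxes lam"
    by (simp add: mem_boxes_iff)
  with assms(2) have "(r, lam r) \<in> boxes nu" by blast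
  then show ?thesis by (simp add: mem_boxes_iff)
qed

lemma boxes_down_closed:
  assumes "young_diagram lam" "(c, d) \<in> boxes lam" "1 \<le> a" "a \<le> c" "1 \<le> b" "b \<le> d"
  shows "(a, b) \<in> boxes lam"
  using assms young_diagram_antimono[of lam a c] by (auto simp: mem_boxes_iff)

text \<open>Order convexity for \<open>le_P\<close> is what lets the rectangle arguments find
  further boxes. It holds for straight and skew shapes alike, so source and target of a picture can
  be treated in the same way.\<close>

definition P_convex :: "box set \<Rightarrow> bool" where
  "P_convex X \<longleftrightarrow> (\<forall>x\<in>X. \<forall>z\<in>X. \<forall>y. le_P x y \<and> le_P y z \<longrightarrow> y \<in> X)"

lemma P_convex_skew:
  assumes "young_diagram lam" "young_diagram nu"
  shows "P_convex (boxes nu - boxes lam)"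
  unfolding P_convex_def
proof safe
  fix a b c d p q
  assume *: "le_P (a, b) (p, q)" "le_P (p, q) (c, d)"
    and ab: "(a, b) \<in> boxes nu" "(a, b) \<notin> boxes lam" and cd: "(c, d) \<in> boxes nu"
  then show "(p, q) \<in> boxes nu"
    by (intro boxes_down_closed[OF assms(2) cd]) (auto simp: le_P_iff mem_boxes_iff)
  assume pq: "(p, q) \<in> boxes lam"
  have "(a, b) \<in> boxes lam"
    using * ab by (intro boxes_down_closed[OF assms(1) pq]) (auto simp: le_P_iff mem_boxes_iff)
  with ab show False by simp
qed

text \<open>A straight shape is a skew shape over the empty diagram.\<close>

lemma P_convex_boxes:
  assumes "young_diagram lam"
  shows "P_convex (boxes lam)"
proof -
  have "boxes (\<lambda>_. 0) = {}"
    by (auto simp: boxes_def)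
  moreover have "young_diagram (\<lambda>_. 0)"
    by (simp add: young_diagram_def)
  ultimately show ?thesis
    using P_convex_skew[of "\<lambda>_. 0" lam] assms by simp
qed

text \<open>\<open>admissible_order_SW\<close> is the only clause that sees the position of boxes in
  the plane. Combined with antisymmetry it refutes any relation pointing from a box to a different
  one weakly north-east of it.\<close>

lemma admissible_orderD:
  assumes "admissible_order X A"
  shows admissible_order_SW:
      "\<lbrakk>(a, b) \<in> X; (c, d) \<in> X; a \<le> c; d \<le> b\<rbrakk> \<Longrightarrow> ((a, b), (c, d)) \<in> A"
    and admissible_order_antisym: "\<lbrakk>(x, y) \<in> A; (y, x) \<in> A\<rbrakk> \<Longrightarrow> x = y"
    and admissible_order_trans: "\<lbrakk>(x, y) \<in> A; (y, z) \<in> A\<rbrakk> \<Longrightarrow> (x, z) \<in> A"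
    and admissible_order_refl: "x \<in> X \<Longrightarrow> (x, x) \<in> A"
    and admissible_order_total: "\<lbrakk>x \<in> X; y \<in> X\<rbrakk> \<Longrightarrow> (x, y) \<in> A \<or> (y, x) \<in> A"
  using assms
  unfolding admissible_order_def linear_order_on_def partial_order_on_def preorder_on_def
  by (blast, blast dest: antisymD, blast dest: transD, blast dest: refl_onD,
      metis refl_onD total_on_def)

subsection \<open>Readings\<close>

text \<open>If the heads differed, each would occur in the tail of the other list and so come after
  the other head, against antisymmetry.\<close>

lemma sorted_wrt_unique:
  assumes "antisym R" "set xs = set ys" "distinct xs" "distinct ys"
    and "sorted_wrt (\<lambda>x y. (x, y) \<in> R) xs" "sorted_wrt (\<lambda>x y. (x, y) \<in> R) ys"
  shows "xs = ys"
  using assms(2-)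
proof (induction xs arbitrary: ys)
  case (Cons x xs)
  then obtain y ys' where ys: "ys = y # ys'"
    by (cases ys) auto
  have "x = y"
  proof (rule ccontr)
    assume "x \<noteq> y"
    with Cons.prems ys have "x \<in> set ys'" "y \<in> set xs"
      by auto
    with Cons.prems ys have "(y, x) \<in> R" "(x, y) \<in> R"
      by auto
    with assms(1) \<open>x \<noteq> y\<close> show False
      by (blast dest: antisymD)
  qed
  moreover have "set xs = set ys'"
    using Cons.prems(1-3) ys \<open>x = y\<close> by auto
  then have "xs = ys'"
    using Cons.prems ys by (intro Cons.IH) auto
  ultimately show ?case
    using ys by simp
qed simp

lemma ex_sorted_wrt:
  assumes "finite X" "trans R" "total_on X R" "refl_on X R"
  shows "\<exists>xs. set xs = X \<and> distinct xs \<and> sorted_wrt (\<lambda>x y. (x, y) \<in> R) xs"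
  using assms(1,3,4)
proof (induction X rule: finite_induct)
  case (insert a X)
  then obtain xs where xs: "set xs = X" "distinct xs" "sorted_wrt (\<lambda>x y. (x, y) \<in> R) xs"
    by (auto simp: total_on_def refl_on_def)
  let ?P = "\<lambda>x. (x, a) \<in> R"
  have above: "(a, y) \<in> R" if "y \<in> X" "\<not> ?P y" for y
    using insert.prems(1) insert.hyps(2) that unfolding total_on_def by (metis insert_iff)
  then have "(x, y) \<in> R" if "y \<in> X" "?P x" "\<not> ?P y" for x y
    using that assms(2) by (blast dest: transD)
  with above xs insert.hyps show ?case
    \<comment> \<open>Insertion of \<open>a\<close>: the elements below \<open>a\<close> go to its
      left, the others to its right. Transitivity through \<open>a\<close> orders the two
      groups.\<close>
    by (intro exI[of _ "filter ?P xs @ a # filter (\<lambda>x. \<not> ?P x) xs"])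
      (auto simp: sorted_wrt_append intro: sorted_wrt_filter)
qed simp

lemma ordered_list_props:
  assumes "finite X" "linear_order_on X R"
  shows "set (ordered_list X R) = X \<and> distinct (ordered_list X R) \<and>
    sorted_wrt (\<lambda>x y. (x, y) \<in> R) (ordered_list X R)"
  unfolding ordered_list_def
proof (rule theI', rule ex_ex1I)
  show "\<exists>xs. set xs = X \<and> distinct xs \<and> sorted_wrt (\<lambda>x y. (x, y) \<in> R) xs"
    using assms by (intro ex_sorted_wrt)
      (auto simp: linear_order_on_def partial_order_on_def preorder_on_def)
next
  have "antisym R"
    using assms(2) by (simp add: linear_order_on_def partial_order_on_def)
  then show "xs = ys"
    if "set xs = X \<and> distinct xs \<and> sorted_wrt (\<lambda>x y. (x, y) \<in> R) xs"
      and "set ys = X \<and> distinct ys \<and> sorted_wrt (\<lambda>x y. (x, y) \<in> R) ys" for xs ys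
    using that by (intro sorted_wrt_unique[of R xs ys]) auto
qed

text \<open>Prefixes of the list are initial segments of the order. With \<open>Suc l\<close> the
  prefix ends with, and contains, the entry of index \<open>l\<close>.\<close>

lemma set_take_ordered_list:
  assumes "finite X" "linear_order_on X R" "l < length (ordered_list X R)"
  shows "set (take (Suc l) (ordered_list X R)) = {y \<in> X. (y, ordered_list X R ! l) \<in> R}"
proof -
  define xs where "xs = ordered_list X R"
  have xs: "set xs = X" "distinct xs" "sorted_wrt (\<lambda>x y. (x, y) \<in> R) xs"
    using ordered_list_props[OF assms(1,2)] by (auto simp: xs_def)
  have R: "antisym R" "refl_on X R"
    using assms(2) by (auto simp: linear_order_on_def partial_order_on_def preorder_on_def)
  have l: "l < length xs"
    using assms(3) by (simp add: xs_def)
  have index: "(xs ! k, xs ! l) \<in> R \<longleftrightarrow> k \<le> l" if "k < length xs" for k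
  proof
    assume "(xs ! k, xs ! l) \<in> R"
    show "k \<le> l"
    proof (rule ccontr)
      assume "\<not> k \<le> l"
      then have "(xs ! l, xs ! k) \<in> R"
        using xs(3) that by (auto simp: sorted_wrt_iff_nth_less)
      with R(1) \<open>(xs ! k, xs ! l) \<in> R\<close> have "xs ! k = xs ! l"
        by (blast dest: antisymD)
      with xs(2) that l \<open>\<not> k \<le> l\<close> show False
        by (simp add: nth_eq_iff_index_eq)
    qed
  next
    assume "k \<le> l"
    moreover have "xs ! l \<in> X"
      using l xs(1) by auto
    ultimately show "(xs ! k, xs ! l) \<in> R"
      using xs(3) l R(2) by (cases "k = l") (auto simp: sorted_wrt_iff_nth_less refl_on_def)
  qed
  have "set (take (Suc l) xs) = (!) xs ` {0..<Suc l}"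
    using l by (intro nth_image[symmetric]) simp
  also have "\<dots> = {y \<in> set xs. (y, xs ! l) \<in> R}"
    using index l by (force simp: set_conv_nth less_Suc_eq_le)
  finally show ?thesis
    by (simp add: xs(1) xs_def[symmetric])
qed

lemma count_list_map_distinct:
  assumes "distinct ys"
  shows "count_list (map T ys) r = card {y \<in> set ys. T y = r}"
  using assms
proof (induction ys)
  case (Cons a ys)
  have "{y \<in> set (a # ys). T y = r} =
      (if T a = r then insert a {y \<in> set ys. T y = r} else {y \<in> set ys. T y = r})"
    by auto
  with Cons show ?case by simp
qed simp

text \<open>Additions commute, so only the multiplicity of each row number counts.\<close>

lemma additions_eq: "additions lam is = (\<lambda>r. lam r + count_list is r)"
  unfolding additions_def
  by (induction "is" arbitrary: lam) (auto simp: addition_def fun_eq_iff)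

text \<open>The shape \<open>lam\<^sub>x\<close> of the overview. Counting boxes instead of cutting
  the reading keeps it meaningful before it is known to be a Young diagram.\<close>

definition shape_upto ::
    "(nat \<Rightarrow> nat) \<Rightarrow> box set \<Rightarrow> box rel \<Rightarrow> (box \<Rightarrow> nat) \<Rightarrow> box \<Rightarrow> nat \<Rightarrow> nat" where
  "shape_upto lam X R T x = (\<lambda>r. lam r + card {y \<in> X. (y, x) \<in> R \<and> T y = r})"

text \<open>A nonempty prefix of the reading is determined by the last box in it, so a condition on
  all prefix lengths becomes one on all boxes. This replaces words by initial segments of
  \<open>A'\<close>.\<close>

lemma LR_tableaux_iff:
  assumes "young_diagram mu" "admissible_order (boxes mu) A'"
  shows "T \<in> LR_tableaux n mu lam nu A' \<longleftrightarrow> T \<in> young_tableaux n mu \<and>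
    (\<forall>x\<in>boxes mu. young_diagram (shape_upto lam (boxes mu) A' T x)) \<and>
    nu = (\<lambda>r. lam r + card (entry_boxes mu T r))"
proof -
  let ?X = "boxes mu"
  define xs where "xs = ordered_list ?X A'"
  have lin: "linear_order_on ?X A'"
    using assms(2) by (simp add: admissible_order_def)
  note fin = finite_boxes[OF assms(1)]
  have xs: "set xs = ?X" "distinct xs"
    using ordered_list_props[OF fin lin] by (auto simp: xs_def)
  have reading: "reading mu A' T = map T xs"
    by (simp add: reading_def xs_def)
  have upto: "additions lam (take (Suc l) (map T xs)) = shape_upto lam ?X A' T (xs ! l)"
    if "l < length xs" for l
    using set_take_ordered_list[OF fin lin, of l] that xs(2)
    unfolding additions_eq shape_upto_def take_map xs_def[symmetric]
    by (subst count_list_map_distinct) (auto simp: conj_assoc)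
  have total: "additions lam (map T xs) = (\<lambda>r. lam r + card (entry_boxes mu T r))"
    using count_list_map_distinct[OF xs(2), of T]
    by (simp add: additions_eq xs(1) entry_boxes_def)
  have "(\<forall>k\<in>{1..length xs}. young_diagram (additions lam (take k (map T xs)))) \<longleftrightarrow>
      (\<forall>l<length xs. young_diagram (additions lam (take (Suc l) (map T xs))))"
    unfolding image_Suc_lessThan[symmetric] by auto
  also have "\<dots> \<longleftrightarrow> (\<forall>l<length xs. young_diagram (shape_upto lam ?X A' T (xs ! l)))"
    using upto by simp
  also have "\<dots> \<longleftrightarrow> (\<forall>x\<in>?X. young_diagram (shape_upto lam ?X A' T x))"
    by (simp add: xs(1)[symmetric] all_set_conv_all_nth)
  finally show ?thesis
    unfolding LR_tableaux_def by (auto simp: reading total)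
qed

subsection \<open>Tableaux of pictures\<close>

text \<open>Standardness of the inverse is restated for pairs in the source, which keeps
  \<open>inv_into\<close> out of the arguments about pictures.\<close>

lemma picturesD:
  assumes "f \<in> pictures X Y A A'"
  shows pictures_extensional: "f \<in> extensional X"
    and pictures_bij: "bij_betw f X Y"
    and pictures_mem: "x \<in> X \<Longrightarrow> f x \<in> Y"
    and pictures_eq_iff: "\<lbrakk>x \<in> X; x' \<in> X\<rbrakk> \<Longrightarrow> f x = f x' \<longleftrightarrow> x = x'"
    and pictures_surj: "y \<in> Y \<Longrightarrow> \<exists>x\<in>X. f x = y"
    and pictures_standard: "\<lbrakk>x \<in> X; x' \<in> X; le_P x x'\<rbrakk> \<Longrightarrow> (f x, f x') \<in> A"
    and pictures_inverse_standard:
      "\<lbrakk>x \<in> X; x' \<in> X; le_P (f x) (f x')\<rbrakk> \<Longrightarrow> (x, x') \<in> A'"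
proof -
  have bij: "bij_betw f X Y"
    using assms by (simp add: pictures_def)
  then have inj: "inj_on f X" and img: "f ` X = Y"
    by (auto simp: bij_betw_def)
  show "f \<in> extensional X" "\<lbrakk>x \<in> X; x' \<in> X; le_P x x'\<rbrakk> \<Longrightarrow> (f x, f x') \<in> A"
    using assms by (auto simp: pictures_def PA_standard_def)
  show "bij_betw f X Y" by fact
  show "x \<in> X \<Longrightarrow> f x \<in> Y" "y \<in> Y \<Longrightarrow> \<exists>x\<in>X. f x = y"
    using img by auto
  show "\<lbrakk>x \<in> X; x' \<in> X\<rbrakk> \<Longrightarrow> f x = f x' \<longleftrightarrow> x = x'"
    using inj by (auto dest: inj_onD)
  assume *: "x \<in> X" "x' \<in> X" "le_P (f x) (f x')"
  then have "(inv_into X f (f x), inv_into X f (f x')) \<in> A'"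
    using assms img unfolding pictures_def PA_standard_def by blast
  with inj * show "(x, x') \<in> A'" by simp
qed

lemma picturesI:
  assumes "f \<in> extensional X" "bij_betw f X Y"
    and "\<And>x x'. \<lbrakk>x \<in> X; x' \<in> X; le_P x x'\<rbrakk> \<Longrightarrow> (f x, f x') \<in> A"
    and "\<And>x x'. \<lbrakk>x \<in> X; x' \<in> X; le_P (f x) (f x')\<rbrakk> \<Longrightarrow> (x, x') \<in> A'"
  shows "f \<in> pictures X Y A A'"
proof -
  have "inv_into X f y \<in> X" "f (inv_into X f y) = y" if "y \<in> Y" for y
    using assms(2) that by (auto simp: bij_betw_def inv_into_into f_inv_into_f)
  with assms show ?thesis
    unfolding pictures_def PA_standard_def by (auto simp: bij_betw_def)
qed

text \<open>Strong induction on the row: a violation in row \<open>i\<close> produces one in some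
  row \<open>p < i\<close>.\<close>

lemma picture_row_mono:
  assumes X: "P_convex X" "admissible_order X A'" and Y: "P_convex Y" "admissible_order Y A"
    and f: "f \<in> pictures X Y A A'"
    and "(i, j) \<in> X" "(i, j') \<in> X" "j < j'"
  shows "fst (f (i, j)) \<le> fst (f (i, j'))"
  using assms(6-)
proof (induction i arbitrary: j j' rule: less_induct)
  case (less i)
  note mem = pictures_mem[OF f] and std = pictures_standard[OF f]
    and inv_std = pictures_inverse_standard[OF f] and f_eq = pictures_eq_iff[OF f]
  note SW_X = admissible_order_SW[OF X(2)] and SW_Y = admissible_order_SW[OF Y(2)]
  note anti_X = admissible_order_antisym[OF X(2)] and anti_Y = admissible_order_antisym[OF Y(2)]
  obtain a b c d where ab: "f (i, j) = (a, b)" and cd: "f (i, j') = (c, d)"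
    by (meson surj_pair)
  have abY: "(a, b) \<in> Y" and cdY: "(c, d) \<in> Y"
    using mem[OF less.prems(1)] mem[OF less.prems(2)] ab cd by auto
  have le1: "((a, b), (c, d)) \<in> A"
    using std[OF less.prems(1,2)] less.prems(3) ab cd by (simp add: le_P_iff)
  show ?case
  proof (rule ccontr)
    assume "\<not> ?thesis"
    then have ca: "c < a" using ab cd by simp
    \<comment> \<open>Otherwise \<open>(c, d)\<close> would be weakly north-east of
      \<open>(a, b)\<close> and precede it in \<open>A\<close>.\<close>
    have db: "d < b"
    proof (rule ccontr)
      assume "\<not> d < b"
      then have "((c, d), (a, b)) \<in> A"
        using SW_Y[OF cdY abY] ca by simp
      with le1 anti_Y ca show False by blast
    qed
    \<comment> \<open>The images are the north-west corner \<open>(c, d)\<close> and the south-east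
      corner \<open>(a, b)\<close> of a rectangle; \<open>(c, b)\<close> is its north-east
      corner.\<close>
    have "(c, b) \<in> Y"
      using Y(1) abY cdY ca db unfolding P_convex_def by (force simp: le_P_iff)
    then obtain p q where z: "(p, q) \<in> X" "f (p, q) = (c, b)"
      using pictures_surj[OF f] by (metis surj_pair)
    have z_ne: "(p, q) \<noteq> (i, j)" "(p, q) \<noteq> (i, j')"
      using z ab cd ca db by auto
    have x'z: "((i, j'), (p, q)) \<in> A'"
      using inv_std[OF less.prems(2) z(1)] z cd db by (simp add: le_P_iff)
    have zx: "((p, q), (i, j)) \<in> A'"
      using inv_std[OF z(1) less.prems(1)] z ab ca by (simp add: le_P_iff)
    \<comment> \<open>The preimage \<open>(p, q)\<close> is read after \<open>(i, j')\<close> and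
      before \<open>(i, j)\<close>. By 2 and 4 it cannot lie in row \<open>i\<close> or below; being
      above, it must by 1 be left of column \<open>j'\<close>.\<close>
    have 1: "\<not> (p \<le> i \<and> j' \<le> q)"
      using SW_X[OF z(1) less.prems(2)] x'z anti_X z_ne by blast
    have 2: "\<not> (i \<le> p \<and> q \<le> j)"
      using SW_X[OF less.prems(1) z(1)] zx anti_X z_ne by blast
    have 3: "\<not> (i \<le> p \<and> j' \<le> q)"
    proof
      assume "i \<le> p \<and> j' \<le> q"
      then have "((c, d), (c, b)) \<in> A"
        using std[OF less.prems(2) z(1)] z cd by (simp add: le_P_iff)
      moreover have "((c, b), (c, d)) \<in> A"
        using SW_Y[OF \<open>(c, b) \<in> Y\<close> cdY] db by simp
      ultimately show False using anti_Y db by blast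
    qed
    have 4: "\<not> (i \<le> p \<and> j \<le> q)"
    proof
      assume "i \<le> p \<and> j \<le> q"
      then have "((a, b), (c, b)) \<in> A"
        using std[OF less.prems(1) z(1)] z ab by (simp add: le_P_iff)
      moreover have "((c, b), (a, b)) \<in> A"
        using SW_Y[OF \<open>(c, b) \<in> Y\<close> abY] ca by simp
      ultimately show False using anti_Y ca by blast
    qed
    from 1 2 3 4 have pi: "p < i" and qj: "q < j'" by linarith+
    \<comment> \<open>The box of row \<open>p\<close> above \<open>(i, j')\<close>. Its image turns
      out to lie in a row above \<open>c\<close>, the image row of \<open>(p, q)\<close>, which is
      the violation in row \<open>p\<close>.\<close>
    have u: "(p, j') \<in> X"
      using X(1) z(1) less.prems(2) pi qj unfolding P_convex_def by (force simp: le_P_iff)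
    obtain r s where rs: "f (p, j') = (r, s)"
      by (meson surj_pair)
    have rsY: "(r, s) \<in> Y" using mem[OF u] rs by simp
    have "((c, b), (r, s)) \<in> A"
      using std[OF z(1) u] z rs qj by (simp add: le_P_iff)
    moreover have "(r, s) \<noteq> (c, b)"
      using f_eq[OF u z(1)] rs z qj by auto
    ultimately have 5: "\<not> (r \<le> c \<and> b \<le> s)"
      using SW_Y[OF rsY \<open>(c, b) \<in> Y\<close>] anti_Y by blast
    have "((r, s), (c, d)) \<in> A"
      using std[OF u less.prems(2)] cd rs pi by (simp add: le_P_iff)
    moreover have "(r, s) \<noteq> (c, d)"
      using f_eq[OF u less.prems(2)] rs cd pi by auto
    ultimately have 6: "\<not> (c \<le> r \<and> s \<le> d)"
      using SW_Y[OF cdY rsY] anti_Y by blast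
    have 7: "\<not> (c \<le> r \<and> d \<le> s)"
    proof
      assume "c \<le> r \<and> d \<le> s"
      then have "((i, j'), (p, j')) \<in> A'"
        using inv_std[OF less.prems(2) u] cd rs by (simp add: le_P_iff)
      moreover have "((p, j'), (i, j')) \<in> A'"
        using SW_X[OF u less.prems(2)] pi by simp
      ultimately show False using anti_X pi by blast
    qed
    from 5 6 7 have "r < c" by linarith
    with less.IH[OF pi z(1) u qj] z rs show False by simp
  qed
qed

text \<open>If the row did not increase, standardness would push the image of the lower box strictly
  to the left. That image would then be north-west of the other one, so the lower box would be read
  first, against admissibility of \<open>A'\<close>.\<close>

lemma picture_column_strict_mono:
  assumes X: "admissible_order X A'" and Y: "admissible_order Y A"
    and f: "f \<in> pictures X Y A A'"
    and x: "(i, j) \<in> X" and x': "(i', j) \<in> X" and "i < i'"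
  shows "fst (f (i, j)) < fst (f (i', j))"
proof (rule ccontr)
  assume *: "\<not> ?thesis"
  obtain a b c d where ab: "f (i, j) = (a, b)" and cd: "f (i', j) = (c, d)"
    by (meson surj_pair)
  have ne: "(a, b) \<noteq> (c, d)"
    using pictures_eq_iff[OF f x x'] \<open>i < i'\<close> ab cd by auto
  have "((a, b), (c, d)) \<in> A"
    using pictures_standard[OF f x x'] \<open>i < i'\<close> ab cd by (simp add: le_P_iff)
  with ne have "((c, d), (a, b)) \<notin> A"
    using admissible_order_antisym[OF Y] by blast
  then have "d < b"
    using admissible_order_SW[OF Y, of c d a b] pictures_mem[OF f x] pictures_mem[OF f x'] * ab cd
    by fastforce
  then have "((i', j), (i, j)) \<in> A'"
    using pictures_inverse_standard[OF f x' x] * ab cd by (simp add: le_P_iff)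
  moreover have "((i, j), (i', j)) \<in> A'"
    using admissible_order_SW[OF X x x'] \<open>i < i'\<close> by simp
  ultimately show False
    using admissible_order_antisym[OF X] \<open>i < i'\<close> by blast
qed

subsection \<open>Positions in the reading\<close>

lemma young_tableaux_row:
  "\<lbrakk>T \<in> young_tableaux n mu; (i, j) \<in> boxes mu; (i, j') \<in> boxes mu; j \<le> j'\<rbrakk>
    \<Longrightarrow> T (i, j) \<le> T (i, j')"
  unfolding young_tableaux_def le_less by blast

lemma young_tableaux_column:
  "\<lbrakk>T \<in> young_tableaux n mu; (i, j) \<in> boxes mu; (i', j) \<in> boxes mu; i < i'\<rbrakk>
    \<Longrightarrow> T (i, j) < T (i', j)"
  unfolding young_tableaux_def by blast

text \<open>Equal entries form a horizontal strip. If \<open>(l, m)\<close> were lower, the box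
  \<open>(i, m)\<close> above it would have an entry at least \<open>T (i, j)\<close> and less than
  \<open>T (l, m)\<close>.\<close>

lemma equal_entries_SW:
  assumes T: "T \<in> young_tableaux n mu" and mu: "young_diagram mu"
    and x: "(i, j) \<in> boxes mu" and y: "(l, m) \<in> boxes mu"
    and eq: "T (i, j) = T (l, m)" and "j \<le> m"
  shows "l \<le> i"
proof (rule ccontr)
  assume "\<not> l \<le> i"
  then have im: "(i, m) \<in> boxes mu"
    using boxes_down_closed[OF mu y, of i m] x y by (simp add: mem_boxes_iff)
  have "T (i, j) \<le> T (i, m)"
    using young_tableaux_row[OF T x im] \<open>j \<le> m\<close> by simp
  also have "\<dots> < T (l, m)"
    using young_tableaux_column[OF T im y] \<open>\<not> l \<le> i\<close> by simp
  finally show False using eq by simp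
qed

text \<open>The boxes with a given entry form a chain from north-east to south-west, on which all
  admissible orders agree. This identifies the position counted from the right with the position in
  the reading.\<close>

lemma equal_entries_order:
  assumes T: "T \<in> young_tableaux n mu" and mu: "young_diagram mu"
    and A': "admissible_order (boxes mu) A'"
    and x: "(i, j) \<in> boxes mu" and y: "(l, m) \<in> boxes mu" and eq: "T (i, j) = T (l, m)"
  shows "((l, m), (i, j)) \<in> A' \<longleftrightarrow> j \<le> m"
proof
  assume "j \<le> m"
  with equal_entries_SW[OF T mu x y eq] show "((l, m), (i, j)) \<in> A'"
    by (intro admissible_order_SW[OF A' y x]) auto
next
  assume *: "((l, m), (i, j)) \<in> A'"
  show "j \<le> m"
  proof (rule ccontr)
    assume "\<not> j \<le> m"
    with equal_entries_SW[OF T mu y x eq[symmetric]] have "((i, j), (l, m)) \<in> A'"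
      by (intro admissible_order_SW[OF A' x y]) auto
    with * admissible_order_antisym[OF A'] \<open>\<not> j \<le> m\<close> show False by blast
  qed
qed

text \<open>The second coordinate is the length of row \<open>T x\<close> just after
  \<open>x\<close> is read, so the value is the box added at that moment.\<close>

lemma Psi_eq:
  assumes T: "T \<in> young_tableaux n mu" and mu: "young_diagram mu"
    and A': "admissible_order (boxes mu) A'" and x: "x \<in> boxes mu"
  shows "Psi lam mu T x = (T x, shape_upto lam (boxes mu) A' T x (T x))"
proof -
  obtain i j where ij: "x = (i, j)" by (cases x)
  have "{(l, m) \<in> entry_boxes mu T (T (i, j)). j \<le> m} =
      {y \<in> boxes mu. (y, x) \<in> A' \<and> T y = T x}"
    using equal_entries_order[OF T mu A' x[unfolded ij]]
    by (auto simp: entry_boxes_def ij)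
  then show ?thesis
    using x by (simp add: Psi_def position_def shape_upto_def ij)
qed

lemma less_shape_upto:
  assumes "young_diagram mu" "admissible_order (boxes mu) A'" "x \<in> boxes mu"
  shows "lam (T x) < shape_upto lam (boxes mu) A' T x (T x)"
proof -
  have "x \<in> {y \<in> boxes mu. (y, x) \<in> A' \<and> T y = T x}"
    using assms(3) admissible_order_refl[OF assms(2,3)] by simp
  moreover have "finite {y \<in> boxes mu. (y, x) \<in> A' \<and> T y = T x}"
    using finite_boxes[OF assms(1)] by simp
  ultimately have "0 < card {y \<in> boxes mu. (y, x) \<in> A' \<and> T y = T x}"
    unfolding card_gt_0_iff by blast
  then show ?thesis
    by (simp add: shape_upto_def)
qed

text \<open>Membership compares how many entries \<open>T w\<close> are read up to \<open>w\<close>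
  and up to \<open>x\<close>. These two sets of boxes are nested, and if \<open>x\<close> comes
  strictly before \<open>w\<close>, only the first contains \<open>w\<close>.\<close>

lemma Psi_mem_shape_upto_iff:
  assumes T: "T \<in> young_tableaux n mu" and mu: "young_diagram mu"
    and A': "admissible_order (boxes mu) A'" and w: "w \<in> boxes mu" and x: "x \<in> boxes mu"
  shows "Psi lam mu T w \<in> boxes (shape_upto lam (boxes mu) A' T x) \<longleftrightarrow> (w, x) \<in> A'"
proof -
  note fin = finite_boxes[OF mu] and trans = admissible_order_trans[OF A']
  let ?S = "\<lambda>x. {y \<in> boxes mu. (y, x) \<in> A' \<and> T y = T w}"
  have w_mem: "w \<in> ?S w"
    using w admissible_order_refl[OF A'] by simp
  have "1 \<le> T w"
    using T w by (cases w) (auto simp: young_tableaux_def PiE_def Pi_def)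
  moreover have "lam (T w) < shape_upto lam (boxes mu) A' T w (T w)"
    by (rule less_shape_upto[OF mu A' w])
  ultimately have "Psi lam mu T w \<in> boxes (shape_upto lam (boxes mu) A' T x) \<longleftrightarrow>
      card (?S w) \<le> card (?S x)"
    by (simp add: Psi_eq[OF T mu A' w] mem_boxes_iff shape_upto_def)
  also have "\<dots> \<longleftrightarrow> (w, x) \<in> A'"
  proof
    assume "(w, x) \<in> A'"
    then have "?S w \<subseteq> ?S x"
      using trans by blast
    then show "card (?S w) \<le> card (?S x)"
      using fin by (intro card_mono) auto
  next
    assume le: "card (?S w) \<le> card (?S x)"
    show "(w, x) \<in> A'"
    proof (rule ccontr)
      assume nwx: "(w, x) \<notin> A'"
      then have "(x, w) \<in> A'"
        using admissible_order_total[OF A' w x] by blast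
      then have "?S x \<subset> ?S w"
        using w_mem nwx trans by blast
      then have "card (?S x) < card (?S w)"
        using fin by (intro psubset_card_mono) auto
      with le show False by simp
    qed
  qed
  finally show ?thesis .
qed

lemma Psi_mem_shape_upto:
  assumes "T \<in> young_tableaux n mu" "young_diagram mu"
    and "admissible_order (boxes mu) A'" "x \<in> boxes mu"
  shows "Psi lam mu T x \<in> boxes (shape_upto lam (boxes mu) A' T x)"
  using Psi_mem_shape_upto_iff[OF assms assms(4)] admissible_order_refl[OF assms(3,4)] by simp

lemma Phi_apply: "x \<in> boxes mu \<Longrightarrow> Phi mu f x = fst (f x)"
  by (auto simp: Phi_def)

lemma fst_Psi: "x \<in> boxes mu \<Longrightarrow> fst (Psi lam mu T x) = T x"
  by (cases x) (simp add: Psi_def)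

lemma Phi_Psi:
  assumes "T \<in> young_tableaux n mu"
  shows "Phi mu (Psi lam mu T) = T"
proof
  fix x
  \<comment> \<open>Off the shape both sides are \<open>undefined\<close>.\<close>
  have "T \<in> extensional (boxes mu)"
    using assms by (simp add: young_tableaux_def PiE_def)
  then show "Phi mu (Psi lam mu T) x = T x"
    using extensional_arb[of T "boxes mu" x]
    by (cases "x \<in> boxes mu") (simp_all add: Phi_apply fst_Psi, simp add: Phi_def)
qed

subsection \<open>From pictures to tableaux\<close>

context
  fixes n :: nat and lam mu nu :: "nat \<Rightarrow> nat" and A A' :: "box rel"
  assumes lam: "young_diagram lam" and mu: "young_diagram mu" and nu: "young_diagram nu"
    and sub: "boxes lam \<subseteq> boxes nu"
    and A: "admissible_order (boxes nu - boxes lam) A"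
    and A': "admissible_order (boxes mu) A'"
begin

private abbreviation (input) Pic :: "(box \<Rightarrow> box) set" where
  "Pic \<equiv> pictures (boxes mu) (boxes nu - boxes lam) A A'"

private abbreviation (input) Up :: "(box \<Rightarrow> nat) \<Rightarrow> box \<Rightarrow> nat \<Rightarrow> nat" where
  "Up \<equiv> shape_upto lam (boxes mu) A'"

lemma Phi_young_tableaux:
  assumes rows: "at_most_rows (n + 1) nu" and f: "f \<in> Pic"
  shows "Phi mu f \<in> young_tableaux n mu"
proof -
  \<comment> \<open>Entries are row numbers of boxes of \<open>nu\<close>, which has at most
    \<open>n + 1\<close> rows.\<close>
  have "fst (f x) \<in> {1..n + 1}" if "x \<in> boxes mu" for x
  proof -
    obtain a b where ab: "f x = (a, b)" by (meson surj_pair)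
    then have "(a, b) \<in> boxes nu"
      using pictures_mem[OF f that] by simp
    then have "1 \<le> a" "nu a \<noteq> 0"
      by (auto simp: mem_boxes_iff)
    with rows ab show ?thesis
      by (auto simp: at_most_rows_def not_less[symmetric])
  qed
  then have "Phi mu f \<in> boxes mu \<rightarrow>\<^sub>E {1..n + 1}"
    by (intro PiE_I) (auto simp: Phi_def)
  moreover note picture_row_mono[OF P_convex_boxes[OF mu] A' P_convex_skew[OF lam nu] A f]
    picture_column_strict_mono[OF A' A f]
  ultimately show ?thesis
    by (simp add: young_tableaux_def Phi_apply)
qed

text \<open>The picture matches the counted boxes with columns \<open>lam r + 1\<close> to
  \<open>s\<close> of row \<open>r\<close>. It serves both for initial segments of the reading and,
  with \<open>s = nu r\<close>, for the whole content.\<close>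

lemma card_picture_row:
  assumes f: "f \<in> Pic" and s: "s \<le> nu r"
    and x: "\<And>y. y \<in> boxes mu \<Longrightarrow> fst (f y) = r \<Longrightarrow> P y \<longleftrightarrow> snd (f y) \<le> s"
  shows "card {y \<in> boxes mu. P y \<and> fst (f y) = r} = s - lam r"
proof (cases "r = 0")
  \<comment> \<open>Row number 0 contains no box, and the convention \<open>nu 0 = 0\<close> forces
    \<open>s = 0\<close>.\<close>
  case True
  have "{y \<in> boxes mu. P y \<and> fst (f y) = r} = {}"
    using pictures_mem[OF f] True by (fastforce simp: boxes_def)
  moreover have "s = 0"
    using s nu True by (simp add: young_diagram_def)
  ultimately show ?thesis
    by (simp only: card.empty diff_0_eq_0)
next
  case False
  let ?S = "{y \<in> boxes mu. P y \<and> fst (f y) = r}"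
  have row: "(r, b) \<in> boxes nu - boxes lam \<longleftrightarrow> lam r < b \<and> b \<le> nu r" for b
    using False by (auto simp: mem_boxes_iff)
  have "f ` ?S = Pair r ` {lam r<..s}"
  proof (intro equalityI subsetI)
    fix z assume "z \<in> f ` ?S"
    then obtain y where y: "y \<in> boxes mu" "P y" "fst (f y) = r" "z = f y"
      by blast
    then obtain b where b: "f y = (r, b)"
      by (metis prod.collapse)
    have "lam r < b"
      using pictures_mem[OF f y(1)] row b by simp
    moreover have "b \<le> s"
      using x[OF y(1,3)] y(2) b by simp
    ultimately show "z \<in> Pair r ` {lam r<..s}"
      using y(4) b by simp
  next
    fix z assume "z \<in> Pair r ` {lam r<..s}"
    then obtain b where b: "z = (r, b)" "b \<in> {lam r<..s}"
      by blast
    then have "(r, b) \<in> boxes nu - boxes lam" "b \<le> s"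
      using row s by auto
    then obtain y where "y \<in> boxes mu" "f y = (r, b)"
      using pictures_surj[OF f] by meson
    with x b(1) \<open>b \<le> s\<close> show "z \<in> f ` ?S"
      by (intro image_eqI[of _ _ y]) auto
  qed
  moreover have "inj_on f ?S"
    using pictures_bij[OF f] by (rule inj_on_subset[OF bij_betw_imp_inj_on]) blast
  ultimately have "card ?S = card (Pair r ` {lam r<..s})"
    using card_image[of f ?S] by simp
  also have "\<dots> = s - lam r"
    by (simp add: card_image inj_on_def)
  finally show ?thesis .
qed

text \<open>Boxes of one row are comparable under \<open>le_P\<close>, so by standardness of the
  inverse their preimages are read from left to right. Hence the boxes read up to \<open>x\<close>
  with image in row \<open>r\<close> are those whose image is in a column up to
  \<open>s\<close>.\<close>

lemma Psi_Phi:
  assumes T: "Phi mu f \<in> young_tableaux n mu" and f: "f \<in> Pic"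
  shows "Psi lam mu (Phi mu f) = f"
proof
  fix x
  show "Psi lam mu (Phi mu f) x = f x"
  proof (cases "x \<in> boxes mu")
    case False
    then show ?thesis
      by (simp add: Psi_def extensional_arb[OF pictures_extensional[OF f]])
  next
    case x: True
    obtain r s where rs: "f x = (r, s)" by (meson surj_pair)
    have mem: "(r, s) \<in> boxes nu" "(r, s) \<notin> boxes lam"
      using pictures_mem[OF f x] rs by auto
    have "(y, x) \<in> A' \<longleftrightarrow> snd (f y) \<le> s" if y: "y \<in> boxes mu" "fst (f y) = r" for y
    proof
      assume yx: "(y, x) \<in> A'"
      show "snd (f y) \<le> s"
      proof (rule ccontr)
        assume "\<not> snd (f y) \<le> s"
        then have "le_P (f x) (f y)"
          using y rs by (cases "f y") (simp add: le_P_iff)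
        then have "x = y"
          using pictures_inverse_standard[OF f x y(1)] yx admissible_order_antisym[OF A'] by blast
        with \<open>\<not> snd (f y) \<le> s\<close> rs show False by simp
      qed
    next
      assume "snd (f y) \<le> s"
      then have "le_P (f y) (f x)"
        using y rs by (cases "f y") (simp add: le_P_iff)
      then show "(y, x) \<in> A'"
        by (rule pictures_inverse_standard[OF f y(1) x])
    qed
    then have "card {y \<in> boxes mu. (y, x) \<in> A' \<and> fst (f y) = r} = s - lam r"
      using mem by (intro card_picture_row[OF f]) (auto simp: mem_boxes_iff)
    moreover have "{y \<in> boxes mu. (y, x) \<in> A' \<and> Phi mu f y = r} =
        {y \<in> boxes mu. (y, x) \<in> A' \<and> fst (f y) = r}"
      by (auto simp: Phi_apply)
    \<comment> \<open>As \<open>(r, s)\<close> lies outside \<open>lam\<close>, we have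
      \<open>lam r < s\<close>, and the truncated difference \<open>s - lam r\<close> added to
      \<open>lam r\<close> gives back \<open>s\<close>.\<close>
    ultimately show ?thesis
      using mem rs
      by (auto simp: Psi_eq[OF T mu A' x] Phi_apply[OF x] shape_upto_def mem_boxes_iff)
  qed
qed

lemma content_Phi:
  assumes f: "f \<in> Pic"
  shows "nu = (\<lambda>r. lam r + card (entry_boxes mu (Phi mu f) r))"
proof
  fix r
  have "snd (f y) \<le> nu r" if "y \<in> boxes mu" "fst (f y) = r" for y
    using pictures_mem[OF f that(1)] that(2) by (cases "f y") (auto simp: mem_boxes_iff)
  then have "card {y \<in> boxes mu. True \<and> fst (f y) = r} = nu r - lam r"
    by (intro card_picture_row[OF f]) auto
  moreover have "entry_boxes mu (Phi mu f) r = {y \<in> boxes mu. True \<and> fst (f y) = r}"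
    by (auto simp: entry_boxes_def Phi_apply)
  ultimately show "nu r = lam r + card (entry_boxes mu (Phi mu f) r)"
    using boxes_subset_imp_le[OF lam sub, of r] by simp
qed

lemma shape_upto_le:
  assumes "nu = (\<lambda>r. lam r + card (entry_boxes mu T r))"
  shows "Up T x r \<le> nu r"
proof -
  have "card {y \<in> boxes mu. (y, x) \<in> A' \<and> T y = r} \<le> card (entry_boxes mu T r)"
    using finite_boxes[OF mu] by (intro card_mono) (auto simp: entry_boxes_def)
  then show ?thesis
    using fun_cong[OF assms, of r] by (simp add: shape_upto_def)
qed

text \<open>When the last box of row \<open>Suc r\<close> sticks out beyond row \<open>r\<close> of
  \<open>lam\<close>, it and the box above it are both images. The preimage \<open>v\<close> of the
  upper one is read before the preimage \<open>w\<close> of the lower one, hence also by the time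
  \<open>x\<close> is read.\<close>

lemma young_diagram_shape_upto:
  assumes T: "T \<in> young_tableaux n mu" and content: "nu = (\<lambda>r. lam r + card (entry_boxes mu T r))"
    and f: "Psi lam mu T \<in> Pic" and x: "x \<in> boxes mu"
  shows "young_diagram (Up T x)"
proof -
  let ?f = "Psi lam mu T" and ?k = "Up T x"
  have le: "?k r \<le> nu r" for r
    using content by (rule shape_upto_le)
  have lam_le: "lam r \<le> ?k r" for r
    by (simp add: shape_upto_def)
  have "?k (Suc r) \<le> ?k r" if "1 \<le> r" for r
  proof -
    let ?s = "?k (Suc r)"
    have nu_step: "?s \<le> nu r"
      using le[of "Suc r"] young_diagram_antimono[OF nu that, of "Suc r"] by simp
    consider "?s \<le> lam r" | "lam r < ?s" by linarith
    then show ?thesis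
    proof cases
      case 1
      then show ?thesis using lam_le[of r] by simp
    next
      case 2
      then have "lam (Suc r) < ?s"
        using young_diagram_antimono[OF lam that, of "Suc r"] by simp
      then have "(Suc r, ?s) \<in> boxes nu - boxes lam"
        using le[of "Suc r"] by (auto simp: mem_boxes_iff)
      then obtain w where w: "w \<in> boxes mu" "?f w = (Suc r, ?s)"
        using pictures_surj[OF f] by meson
      have "(r, ?s) \<in> boxes nu - boxes lam"
        using 2 that nu_step by (auto simp: mem_boxes_iff)
      then obtain v where v: "v \<in> boxes mu" "?f v = (r, ?s)"
        using pictures_surj[OF f] by meson
      have "?f w \<in> boxes ?k"
        using w 2 by (auto simp: mem_boxes_iff)
      then have "(w, x) \<in> A'"
        using Psi_mem_shape_upto_iff[OF T mu A' w(1) x] by simp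
      moreover have "(v, w) \<in> A'"
        using pictures_inverse_standard[OF f v(1) w(1)] v w by (simp add: le_P_iff)
      ultimately have "(v, x) \<in> A'"
        using admissible_order_trans[OF A'] by blast
      then have "?f v \<in> boxes ?k"
        using Psi_mem_shape_upto_iff[OF T mu A' v(1) x] by simp
      with v show ?thesis by (simp add: mem_boxes_iff)
    qed
  qed
  moreover have "?k 0 = 0" "\<exists>r. \<forall>i>r. ?k i = 0"
    using le nu unfolding young_diagram_def by (metis le_zero_eq)+
  ultimately show ?thesis
    by (simp add: young_diagram_def)
qed

lemma Phi_LR_tableaux:
  assumes "at_most_rows (n + 1) nu" and f: "f \<in> Pic"
  shows "Phi mu f \<in> LR_tableaux n mu lam nu A'"
proof -
  note T = Phi_young_tableaux[OF assms] and content = content_Phi[OF f]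
  have "Psi lam mu (Phi mu f) \<in> Pic"
    using Psi_Phi[OF T f] f by simp
  with young_diagram_shape_upto[OF T content] show ?thesis
    using T content by (simp add: LR_tableaux_iff[OF mu A'])
qed

subsection \<open>From tableaux to pictures\<close>

text \<open>Boxes with a common image each lie weakly before the other in the reading, so they
  coincide. Surjectivity follows by comparing cardinalities.\<close>

lemma Psi_bij:
  assumes card: "card (boxes lam) + card (boxes mu) = card (boxes nu)"
    and T: "T \<in> young_tableaux n mu" and content: "nu = (\<lambda>r. lam r + card (entry_boxes mu T r))"
  shows "bij_betw (Psi lam mu T) (boxes mu) (boxes nu - boxes lam)"
proof -
  let ?f = "Psi lam mu T"
  note fin_nu = finite_boxes[OF nu]
  have inj: "inj_on ?f (boxes mu)"
  proof
    fix x y assume xy: "x \<in> boxes mu" "y \<in> boxes mu" "?f x = ?f y"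
    then have "(x, y) \<in> A'" "(y, x) \<in> A'"
      using Psi_mem_shape_upto[OF T mu A', of _ lam] Psi_mem_shape_upto_iff[OF T mu A', of _ _ lam]
      by metis+
    then show "x = y"
      by (rule admissible_order_antisym[OF A'])
  qed
  have "?f x \<in> boxes nu - boxes lam" if x: "x \<in> boxes mu" for x
  proof -
    have "?f x \<in> boxes (Up T x)"
      by (rule Psi_mem_shape_upto[OF T mu A' x])
    then show ?thesis
      using shape_upto_le[OF content, of x "T x"] less_shape_upto[OF mu A' x, of lam T]
      by (auto simp: Psi_eq[OF T mu A' x] mem_boxes_iff)
  qed
  moreover have "card (?f ` boxes mu) = card (boxes nu - boxes lam)"
    using card card_Diff_subset[OF finite_subset[OF sub fin_nu] sub] card_image[OF inj] by simp
  ultimately have "?f ` boxes mu = boxes nu - boxes lam"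
    using fin_nu by (intro card_subset_eq) auto
  with inj show ?thesis
    by (simp add: bij_betw_def)
qed

text \<open>The Young diagram at \<open>x\<close> contains the image of \<open>x\<close>, hence
  every box north-west of it, in particular the image of \<open>w\<close>. By
  \<open>Psi_mem_shape_upto_iff\<close>, \<open>w\<close> has been read.\<close>

lemma Psi_inverse_standard:
  assumes T: "T \<in> young_tableaux n mu" and Y: "young_diagram (Up T x)"
    and w: "w \<in> boxes mu" and x: "x \<in> boxes mu" and le: "le_P (Psi lam mu T w) (Psi lam mu T x)"
  shows "(w, x) \<in> A'"
proof -
  let ?f = "Psi lam mu T"
  obtain a b c d where ab: "?f w = (a, b)" and cd: "?f x = (c, d)"
    by (meson surj_pair)
  have cd_mem: "(c, d) \<in> boxes (Up T x)" and ab_mem: "(a, b) \<in> boxes (Up T w)"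
    using Psi_mem_shape_upto[OF T mu A' x, of lam] Psi_mem_shape_upto[OF T mu A' w, of lam] ab cd
    by auto
  have "(a, b) \<in> boxes (Up T x)"
    using le ab cd ab_mem
    by (intro boxes_down_closed[OF Y cd_mem]) (auto simp: le_P_iff mem_boxes_iff)
  then show ?thesis
    using Psi_mem_shape_upto_iff[OF T mu A' w x, of lam] ab by simp
qed

context
  fixes T :: "box \<Rightarrow> nat"
  assumes T: "T \<in> young_tableaux n mu"
    and bij: "bij_betw (Psi lam mu T) (boxes mu) (boxes nu - boxes lam)"
    and inv_std: "\<And>x y. \<lbrakk>x \<in> boxes mu; y \<in> boxes mu; le_P (Psi lam mu T x) (Psi lam mu T y)\<rbrakk>
      \<Longrightarrow> (x, y) \<in> A'"
begin

text \<open>Entries grow weakly along a row. If the second coordinate did not drop,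
  \<open>inv_std\<close> would have the left box read before the right one, which \<open>A'\<close>
  forbids.\<close>

lemma Psi_row_strict_antimono:
  assumes x: "(i, j) \<in> boxes mu" and x': "(i, j') \<in> boxes mu" and "j < j'"
  shows "snd (Psi lam mu T (i, j')) < snd (Psi lam mu T (i, j))"
proof (rule ccontr)
  assume "\<not> ?thesis"
  moreover have "T (i, j) \<le> T (i, j')"
    using young_tableaux_row[OF T x x'] \<open>j < j'\<close> by simp
  ultimately have "le_P (Psi lam mu T (i, j)) (Psi lam mu T (i, j'))"
    using fst_Psi[OF x, of lam T] fst_Psi[OF x', of lam T] by (auto simp: le_P_def split: prod.split)
  then have "((i, j), (i, j')) \<in> A'"
    by (rule inv_std[OF x x'])
  moreover have "((i, j'), (i, j)) \<in> A'"
    using admissible_order_SW[OF A' x' x] \<open>j < j'\<close> by simp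
  ultimately show False
    using admissible_order_antisym[OF A'] \<open>j < j'\<close> by blast
qed

text \<open>Strong induction on the column: a violation in column \<open>j\<close> would produce one
  in a column \<open>q < j\<close>.\<close>

lemma Psi_column_antimono:
  assumes "(i, j) \<in> boxes mu" "(i', j) \<in> boxes mu" "i < i'"
  shows "snd (Psi lam mu T (i', j)) \<le> snd (Psi lam mu T (i, j))"
  using assms
proof (induction j arbitrary: i i' rule: less_induct)
  case (less j)
  let ?f = "Psi lam mu T"
  note x = less.prems(1) and x' = less.prems(2)
  define a b c d where "a = T (i, j)" "b = snd (?f (i, j))" "c = T (i', j)" "d = snd (?f (i', j))"
  then have ab: "?f (i, j) = (a, b)" and cd: "?f (i', j) = (c, d)"
    using fst_Psi[OF x, of lam T] fst_Psi[OF x', of lam T] by (auto simp: prod_eq_iff)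
  have ac: "a < c"
    using young_tableaux_column[OF T x x' less.prems(3)] by (simp add: a_b_c_d_def)
  show ?case
  proof (rule ccontr)
    assume "\<not> ?thesis"
    then have bd: "b < d" using ab cd by simp
    have "(a, b) \<in> boxes nu - boxes lam" "(c, d) \<in> boxes nu - boxes lam"
      using bij_betw_apply[OF bij x] bij_betw_apply[OF bij x'] ab cd by auto
    \<comment> \<open>The north-east corner of the rectangle spanned by the images
      \<open>(a, b)\<close> and \<open>(c, d)\<close>. Its preimage \<open>(p, q)\<close> carries
      the same entry as \<open>(i, j)\<close> and is read after it, hence lies weakly to its
      left.\<close>
    then have "(a, d) \<in> boxes nu - boxes lam"
      using P_convex_skew[OF lam nu] ac bd unfolding P_convex_def
      by (metis le_P_iff less_imp_le order_refl)
    then obtain p q where z: "(p, q) \<in> boxes mu" "?f (p, q) = (a, d)"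
      using bij by (metis bij_betw_imp_surj_on imageE surj_pair)
    have Tz: "T (p, q) = a"
      using fst_Psi[OF z(1), of lam T] z(2) by simp
    have z_ne: "(p, q) \<noteq> (i, j)" "(p, q) \<noteq> (i', j)"
      using z ab cd ac bd by auto
    have xz: "((i, j), (p, q)) \<in> A'"
      using inv_std[OF x z(1)] ab z bd by (simp add: le_P_iff)
    have zx': "((p, q), (i', j)) \<in> A'"
      using inv_std[OF z(1) x'] cd z ac by (simp add: le_P_iff)
    have "q \<le> j"
      using equal_entries_order[OF T mu A' z(1) x] Tz xz by (simp add: a_b_c_d_def)
    have "p < i'"
    proof (rule ccontr)
      assume "\<not> p < i'"
      then have "((i', j), (p, q)) \<in> A'"
        using \<open>q \<le> j\<close> by (intro admissible_order_SW[OF A' x' z(1)]) auto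
      with zx' z_ne admissible_order_antisym[OF A'] show False by blast
    qed
    have "q \<noteq> j"
    proof
      assume "q = j"
      then have "p \<noteq> i" using z_ne by simp
      then show False
        using young_tableaux_column[OF T x, of p] young_tableaux_column[OF T _ x, of p] z(1) Tz \<open>q = j\<close>
        by (cases "p < i") (auto simp: a_b_c_d_def)
    qed
    with \<open>q \<le> j\<close> have "q < j" by simp
    have v: "(i', q) \<in> boxes mu"
      using boxes_down_closed[OF mu x', of i' q] z(1) x' \<open>q < j\<close> by (simp add: mem_boxes_iff)
    \<comment> \<open>Row \<open>i'\<close> shows that the image of \<open>(i', q)\<close> is right
      of column \<open>d\<close>, while the induction hypothesis for \<open>(p, q)\<close> above
      \<open>(i', q)\<close> puts it weakly left of \<open>d\<close>.\<close>
    have "d < snd (?f (i', q))"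
      using Psi_row_strict_antimono[OF v x' \<open>q < j\<close>] cd by simp
    also have "\<dots> \<le> snd (?f (p, q))"
      by (rule less.IH[OF \<open>q < j\<close> z(1) v \<open>p < i'\<close>])
    finally show False using z by simp
  qed
qed

text \<open>Passing from \<open>x\<close> along its row to \<open>(i, j')\<close> and then down to
  \<open>x'\<close>, the image moves weakly south-west, and every admissible order contains that
  relation.\<close>

lemma Psi_standard:
  assumes x: "x \<in> boxes mu" and x': "x' \<in> boxes mu" and le: "le_P x x'"
  shows "(Psi lam mu T x, Psi lam mu T x') \<in> A"
proof -
  let ?f = "Psi lam mu T"
  obtain i j i' j' where ij: "x = (i, j)" "x' = (i', j')"
    by (meson surj_pair)
  have le': "i \<le> i'" "j \<le> j'"
    using le ij by (auto simp: le_P_iff)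
  have u: "(i, j') \<in> boxes mu"
    using boxes_down_closed[OF mu, of i' j' i j'] x x' le' ij by (simp add: mem_boxes_iff)
  have "T x \<le> T (i, j')"
    using young_tableaux_row[OF T _ u, of j] x le' ij by simp
  also have "\<dots> \<le> T x'"
    using young_tableaux_column[OF T u, of i'] x' le' ij by (cases "i = i'") auto
  finally have 1: "fst (?f x) \<le> fst (?f x')"
    using fst_Psi x x' by simp
  have "snd (?f x') \<le> snd (?f (i, j'))"
    using Psi_column_antimono[OF u, of i'] x' le' ij by (cases "i = i'") auto
  also have "\<dots> \<le> snd (?f x)"
    using Psi_row_strict_antimono[OF _ u, of j] x le' ij by (cases "j = j'") auto
  finally show ?thesis
    using admissible_order_SW[OF A, of "fst (?f x)" "snd (?f x)" "fst (?f x')" "snd (?f x')"]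
      1 bij_betw_apply[OF bij x] bij_betw_apply[OF bij x'] by simp
qed

end

lemma Psi_pictures:
  assumes card: "card (boxes lam) + card (boxes mu) = card (boxes nu)"
    and T: "T \<in> LR_tableaux n mu lam nu A'"
  shows "Psi lam mu T \<in> Pic"
proof -
  have T': "T \<in> young_tableaux n mu" and Y: "\<And>x. x \<in> boxes mu \<Longrightarrow> young_diagram (Up T x)"
    and content: "nu = (\<lambda>r. lam r + card (entry_boxes mu T r))"
    using T unfolding LR_tableaux_iff[OF mu A'] by blast+
  note bij = Psi_bij[OF card T' content]
  have inv_std: "(w, x) \<in> A'"
    if "w \<in> boxes mu" "x \<in> boxes mu" "le_P (Psi lam mu T w) (Psi lam mu T x)" for w x
    by (rule Psi_inverse_standard[OF T' Y[OF that(2)] that])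
  show ?thesis
    using Psi_standard[OF T' bij inv_std] bij inv_std
    by (intro picturesI) (auto simp: Psi_def)
qed

end

theorem theorem4p1:
  fixes n :: nat and lam mu nu :: "nat \<Rightarrow> nat" and A A' :: "box rel"
  assumes "n \<ge> 1"
    and "young_diagram lam" and "young_diagram mu" and "young_diagram nu"
    and "at_most_rows (n + 1) lam" and "at_most_rows (n + 1) mu" and "at_most_rows (n + 1) nu"
    and "boxes lam \<subseteq> boxes nu"
    and "card (boxes lam) + card (boxes mu) = card (boxes nu)"
    and "admissible_order (boxes nu - boxes lam) A"
    and "admissible_order (boxes mu) A'"
  shows "Phi mu \<in> pictures (boxes mu) (boxes nu - boxes lam) A A' \<rightarrow> LR_tableaux n mu lam nu A' \<and>
    Psi lam mu \<in> LR_tableaux n mu lam nu A' \<rightarrow> pictures (boxes mu) (boxes nu - boxes lam) A A' \<and>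
    bij_betw (Phi mu) (pictures (boxes mu) (boxes nu - boxes lam) A A') (LR_tableaux n mu lam nu A') \<and>
    bij_betw (Psi lam mu) (LR_tableaux n mu lam nu A') (pictures (boxes mu) (boxes nu - boxes lam) A A') \<and>
    (\<forall>f \<in> pictures (boxes mu) (boxes nu - boxes lam) A A'. Psi lam mu (Phi mu f) = f) \<and>
    (\<forall>T \<in> LR_tableaux n mu lam nu A'. Phi mu (Psi lam mu T) = T)"
proof -
  let ?P = "pictures (boxes mu) (boxes nu - boxes lam) A A'" and ?L = "LR_tableaux n mu lam nu A'"
  note facts = assms(2,3,4,8,10,11)
  have Phi: "Phi mu \<in> ?P \<rightarrow> ?L"
    using Phi_LR_tableaux[OF facts assms(7)] by blast
  have Psi: "Psi lam mu \<in> ?L \<rightarrow> ?P"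
    using Psi_pictures[OF facts assms(9)] by blast
  have Psi_Phi: "\<forall>f\<in>?P. Psi lam mu (Phi mu f) = f"
    using Psi_Phi[OF facts] Phi_young_tableaux[OF facts assms(7)] by blast
  have Phi_Psi: "\<forall>T\<in>?L. Phi mu (Psi lam mu T) = T"
    by (auto simp: LR_tableaux_def intro: Phi_Psi)
  \<comment> \<open>Each map is the witness for the bijectivity of the other.\<close>
  have "bij_betw (Phi mu) ?P ?L" "bij_betw (Psi lam mu) ?L ?P"
    using Phi Psi Psi_Phi Phi_Psi by (auto intro!: bij_betw_byWitness)
  with Phi Psi Psi_Phi Phi_Psi show ?thesis by blast
qed

end
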